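(* Let $G$ be a topological rough group with rough identity element $e$ such that $G$ (with the topology $\tau_G$) is a $T_0$-space. If $e\in G$, then $\{e\}$ is closed in $G$.
   Context: An approximation space $(U,R)$ is a non-empty set $U$ with an equivalence relation $R$; for $X\subset U$ the upper approximation is $\overline{X}=\{x\in U:[x]_R\cap X\neq\emptyset\}$, where $[x]_R$ is the equivalence class of $x$. Let $U$ carry a binary operation, written $xy$. A subset $G\subset U$ is a rough group if: (1) $xy\in\overline{G}$ for all $x,y\in G$; (2) $(xy)z=x(yz)$ for all $x,y,z\in\overline{G}$; (3) there is $e\in\overline{G}$ (the rough identity element) with $ex=xe=x$ for all $x\in\overline{G}$; (4) for every $x\in G$ there is $y\in G$ with $xy=yx=e$ (written $y=x^{-1}$). A topological rough group is a rough group $G$ together with a topology $\tau$ on $\overline{G}$ such that, with $\tau_G$ the subspace topology on $G$, the multiplication $G\times G\to\overline{G}$, $(x,y)\mapsto xy$, is continuous (product topology of $\tau_G$ on $G\times G$, $\tau$ on $\overline{G}$) and the inverse mapping $G\to G$, $x\mapsto x^{-1}$, is continuous for $\tau_G$. *)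

theory Defs
  imports "HOL-Analysis.Analysis"
begin

locale approximation_space =
  fixes U :: "'a set" and R :: "('a \<times> 'a) set"
  assumes nonempty: "U \<noteq> {}"
    and equiv_rel: "equiv U R"
begin

definition upper_approx :: "'a set \<Rightarrow> 'a set" where
  "upper_approx X = {x \<in> U. R `` {x} \<inter> X \<noteq> {}}"

end

text \<open>The rough identity is unique (see \<open>rough_identity_unique\<close> below), so it is a
  parameter of the locale rather than being existentially quantified.\<close>

locale rough_group = approximation_space U R
  for U :: "'a set" and R :: "('a \<times> 'a) set" +
  fixes mult :: "'a \<Rightarrow> 'a \<Rightarrow> 'a" (infixl "\<cdot>" 70)
    and G :: "'a set"
    and e :: 'a
  assumes mult_closed: "\<lbrakk>x \<in> U; y \<in> U\<rbrakk> \<Longrightarrow> x \<cdot> y \<in> U"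
    and subset_universe: "G \<subseteq> U"
    and mult_in_upper: "\<lbrakk>x \<in> G; y \<in> G\<rbrakk> \<Longrightarrow> x \<cdot> y \<in> upper_approx G"
    and assoc: "\<lbrakk>x \<in> upper_approx G; y \<in> upper_approx G; z \<in> upper_approx G\<rbrakk>
                  \<Longrightarrow> (x \<cdot> y) \<cdot> z = x \<cdot> (y \<cdot> z)"
    and identity_in_upper: "e \<in> upper_approx G"
    and identity: "x \<in> upper_approx G \<Longrightarrow> e \<cdot> x = x \<and> x \<cdot> e = x"
    and inverse_exists: "x \<in> G \<Longrightarrow> \<exists>y\<in>G. x \<cdot> y = e \<and> y \<cdot> x = e"
begin

definition rough_inv :: "'a \<Rightarrow> 'a" where
  "rough_inv x = (THE y. y \<in> G \<and> x \<cdot> y = e \<and> y \<cdot> x = e)"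

lemma subset_upper: "G \<subseteq> upper_approx G"
  using subset_universe equiv_class_self[OF equiv_rel]
  unfolding upper_approx_def by blast

lemma rough_identity_unique:
  assumes "e' \<in> upper_approx G" and "\<And>x. x \<in> upper_approx G \<Longrightarrow> e' \<cdot> x = x \<and> x \<cdot> e' = x"
  shows "e' = e"
  using assms identity identity_in_upper by metis

lemma rough_inv_unique:
  assumes "x \<in> G"
  shows "\<exists>!y. y \<in> G \<and> x \<cdot> y = e \<and> y \<cdot> x = e"
proof -
  have "y = z" if "y \<in> G" "x \<cdot> y = e" "y \<cdot> x = e" "z \<in> G" "x \<cdot> z = e" "z \<cdot> x = e" for y z
  proof -
    have up: "x \<in> upper_approx G" "y \<in> upper_approx G" "z \<in> upper_approx G"
      using assms that subset_upper by auto
    have "y = y \<cdot> (x \<cdot> z)" using identity up that by simp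
    also have "\<dots> = (y \<cdot> x) \<cdot> z" using assoc up by simp
    also have "\<dots> = z" using identity up that by simp
    finally show ?thesis .
  qed
  then show ?thesis using inverse_exists[OF assms] by blast
qed

end

locale topological_rough_group = rough_group U R mult G e
  for U :: "'a set" and R :: "('a \<times> 'a) set"
    and mult :: "'a \<Rightarrow> 'a \<Rightarrow> 'a" (infixl "\<cdot>" 70) and G :: "'a set" and e :: 'a +
  fixes T :: "'a topology"
  assumes topspace_eq: "topspace T = upper_approx G"
    and continuous_mult:
      "continuous_map (prod_topology (subtopology T G) (subtopology T G)) T (\<lambda>(x, y). x \<cdot> y)"
    and continuous_inv:
      "continuous_map (subtopology T G) (subtopology T G) rough_inv"

end

theory Submission
  imports Defs
begin

text \<open>If an open set \<open>W\<close> contains \<open>e\<close> but not \<open>x\<close>, then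
  \<open>{y \<in> G. y\<inverse> \<cdot> x \<in> W}\<close> is an open neighbourhood of \<open>x\<close> that misses \<open>e\<close>, because
  \<open>x\<inverse> \<cdot> x = e\<close> and \<open>e\<inverse> \<cdot> x = x\<close>. So the \<open>T\<^sub>0\<close> axiom, whichever of the two
  points it separates, always yields a neighbourhood of \<open>x\<close> avoiding \<open>e\<close>. The products
  \<open>y\<inverse> \<cdot> x\<close> may leave \<open>G\<close>, so \<open>W\<close> has to be open in \<open>T\<close>, not only in \<open>G\<close>.\<close>

context rough_group
begin

lemma rough_inv:
  assumes "x \<in> G"
  shows "rough_inv x \<in> G" "x \<cdot> rough_inv x = e" "rough_inv x \<cdot> x = e"
  using theI'[OF rough_inv_unique[OF assms]] unfolding rough_inv_def by auto

lemma rough_inv_identity: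
  assumes "e \<in> G"
  shows "rough_inv e = e"
  using rough_inv(1,2)[OF assms] identity subset_upper by (metis subsetD)

end

context topological_rough_group
begin

lemma topspace_subtopology_G: "topspace (subtopology T G) = G"
  using topspace_eq subset_upper by (simp add: Int_absorb1)

text \<open>Pairing inversion with the constant \<open>x\<close> gives a continuous map from
  \<open>G\<close> into \<open>G \<times> G\<close>, which is then composed with
  multiplication.\<close>

lemma continuous_map_inv_mult:
  assumes "x \<in> G"
  shows "continuous_map (subtopology T G) T (\<lambda>y. rough_inv y \<cdot> x)"
proof -
  have "continuous_map (subtopology T G) (prod_topology (subtopology T G) (subtopology T G))
          (\<lambda>y. (rough_inv y, x))"
    using assms by (intro continuous_map_pairedI continuous_inv)
      (simp add: topspace_subtopology_G del: topspace_subtopology)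
  from continuous_map_compose[OF this continuous_mult] show ?thesis
    by (simp add: o_def)
qed

lemma neighbourhood_avoiding_identity:
  assumes t0: "t0_space (subtopology T G)" and "e \<in> G" and "x \<in> G" and "x \<noteq> e"
  obtains V where "openin (subtopology T G) V" "x \<in> V" "e \<notin> V"
proof -
  obtain W where W: "openin (subtopology T G) W" "x \<notin> W \<longleftrightarrow> e \<in> W"
    using t0 assms(2-4) unfolding t0_space_def topspace_subtopology_G by blast
  show thesis
  proof (cases "x \<in> W")
    case True
    then show thesis using W that by blast
  next
    case False
    obtain W' where W': "openin T W'" "W = W' \<inter> G"
      using W(1) by (auto simp: openin_subtopology)
    have "openin (subtopology T G) {y \<in> G. rough_inv y \<cdot> x \<in> W'}"
      using openin_continuous_map_preimage[OF continuous_map_inv_mult[OF \<open>x \<in> G\<close>] W'(1)]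
      by (simp only: topspace_subtopology_G)
    moreover have "rough_inv x \<cdot> x \<in> W'"
      using False W W' rough_inv(3)[OF \<open>x \<in> G\<close>] by auto
    \<comment> \<open>This product is \<open>x\<close>, which lies in \<open>G\<close> but not in
      \<open>W = W' \<inter> G\<close>, hence not in \<open>W'\<close>.\<close>
    moreover have "rough_inv e \<cdot> x \<notin> W'"
      using False W' \<open>x \<in> G\<close> rough_inv_identity[OF \<open>e \<in> G\<close>] identity subset_upper by auto
    ultimately show thesis using that \<open>x \<in> G\<close> by blast
  qed
qed

text \<open>The neighbourhoods avoiding \<open>e\<close>, one for each other point of
  \<open>G\<close>, together fill the complement of \<open>{e}\<close>.\<close>

lemma closedin_identity:
  assumes "t0_space (subtopology T G)" and "e \<in> G"
  shows "closedin (subtopology T G) {e}"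
proof -
  have "\<exists>V. openin (subtopology T G) V \<and> x \<in> V \<and> V \<subseteq> G - {e}" if x: "x \<in> G - {e}" for x
  proof -
    from x have "x \<in> G" "x \<noteq> e"
      by simp_all
    from neighbourhood_avoiding_identity[OF assms this]
    obtain V where V: "openin (subtopology T G) V" "x \<in> V" "e \<notin> V" .
    moreover have "V \<subseteq> G"
      using openin_subset[OF V(1)] unfolding topspace_subtopology_G .
    ultimately show ?thesis by blast
  qed
  then have "openin (subtopology T G) (G - {e})"
    by (subst openin_subopen) blast
  then show ?thesis
    using assms(2) unfolding closedin_def topspace_subtopology_G by blast
qed

end

theorem proposition3p5:
  fixes U :: "'a set" and R :: "('a \<times> 'a) set" and mult :: "'a \<Rightarrow> 'a \<Rightarrow> 'a"
    and G :: "'a set" and e :: 'a and T :: "'a topology"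
  assumes "topological_rough_group U R mult G e T"
    and "t0_space (subtopology T G)"
    and "e \<in> G"
  shows "closedin (subtopology T G) {e}"
  using topological_rough_group.closedin_identity[OF assms] .

end
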